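(* Let $F$ be a positive integer and let $$\mathrm{L}(F)=\left\{ l \in \mathbb{N} \;\Big\vert\; \frac{F}{2}<l<F \text{ and } \big((F-l)\mid F \text{ or } (2l-F)\nmid F\big) \right\}.$$ For each $l\in\mathrm{L}(F)$, identify the elements of $\mathcal{I}(l)$ and $\mathcal{I}(F)$ with their Kunz-coordinates vectors in $\{0,1\}^{l}$ and $\{0,1\}^{F}$ respectively, put $$A=\{(x_1,\ldots,x_{l},0,\ldots,0)\in\{0,1\}^{F} \mid (x_1,\ldots,x_{l})\in\mathcal{I}(l)\},$$ $$B_0=\{(x_1,\ldots,x_{F})\in\mathcal{I}(F)\mid x_{l}=0\},\qquad B_1=\{(x_1,\ldots,x_{F})\in\mathcal{I}(F)\mid x_{l}=1\},$$ $$C=\mathrm{minimals}\{a\vee b\mid a\in A \text{ and } b\in B_0\},$$ and let $\mathcal{N}(F,l)$ be the set of numerical semigroups with Frobenius number $F$ whose Kunz-coordinates vector belongs to $\{c\in C\mid b\vee c\neq c \text{ for all } b\in B_1\}$. Then, for each $l\in\mathrm{L}(F)$, $$\mathcal{N}(F,l)=\{S\mid S\text{ is a numerical semigroup with }\mathrm{E}(S)=\{l,F\}\},$$ and $$\mathcal{A}(F)=\mathcal{I}(F)\cup\Big(\bigcup_{l\in\mathrm{L}(F)}\mathcal{N}(F,l)\Big).$$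
   Context: $\mathbb{N}$ denotes the set of non-negative integers. A numerical semigroup is a subset $S\subseteq\mathbb{N}$ that is closed under addition, contains $0$, and has finite complement $\mathbb{N}\setminus S$. The Frobenius number $\mathrm{F}(S)$ is the greatest integer not belonging to $S$. For a positive integer $F$, $\mathcal{S}(F)$ is the set of all numerical semigroups with Frobenius number $F$. A numerical semigroup is irreducible if it cannot be expressed as the intersection of two numerical semigroups containing it properly; $\mathcal{I}(F)$ is the set of all irreducible numerical semigroups with Frobenius number $F$. A semigroup $S\in\mathcal{S}(F)$ is atomic if it cannot be expressed as the intersection of two elements of $\mathcal{S}(F)$ containing it properly; $\mathcal{A}(F)$ is the set of all atomic numerical semigroups in $\mathcal{S}(F)$. The set of special gaps of $S$ is $$\mathrm{E}(S)=\{x\in\mathbb{N}\setminus S \mid 2x\in S \text{ and } x+s\in S \text{ for all } s\in S\setminus\{0\}\}.$$ A numerical semigroup $S$ with Frobenius number $F$ is represented by its Kunz-coordinates vector $(x_1,\ldots,x_F)\in\{0,1\}^F$, where $x_i=0$ if and only if $i\in S$. For $(a_1,\ldots,a_n),(b_1,\ldots,b_n)\in\mathbb{N}^n$, $(a_1,\ldots,a_n)\vee(b_1,\ldots,b_n)=(\max\{a_1,b_1\},\ldots,\max\{a_n,b_n\})$. For $X\subseteq\mathbb{N}^n$, $\mathrm{minimals}(X)$ is the set of minimal elements of $X$ with respect to the usual component-wise order. *)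

theory Defs
  imports Complex_Main
begin

definition numerical_semigroup :: "nat set \<Rightarrow> bool" where
  "numerical_semigroup S \<longleftrightarrow>
     (\<forall>x\<in>S. \<forall>y\<in>S. x + y \<in> S) \<and> 0 \<in> S \<and> finite (UNIV - S)"

text \<open>The greatest integer outside \<open>S\<close>; it is integer-valued because \<open>\<nat>\<close> itself has
  Frobenius number \<open>-1\<close>.\<close>

definition frobenius :: "nat set \<Rightarrow> int" where
  "frobenius S = (GREATEST z. z \<notin> int ` S)"

definition semigroups_frob :: "nat \<Rightarrow> nat set set" where
  "semigroups_frob F = {S. numerical_semigroup S \<and> frobenius S = int F}"

definition irreducible_semigroup :: "nat set \<Rightarrow> bool" where
  "irreducible_semigroup S \<longleftrightarrow> numerical_semigroup S \<and>
     \<not> (\<exists>T U. numerical_semigroup T \<and> numerical_semigroup U \<and>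
            S \<subset> T \<and> S \<subset> U \<and> S = T \<inter> U)"

definition irreducibles_frob :: "nat \<Rightarrow> nat set set" where
  "irreducibles_frob F = {S \<in> semigroups_frob F. irreducible_semigroup S}"

definition atomics_frob :: "nat \<Rightarrow> nat set set" where
  "atomics_frob F = {S \<in> semigroups_frob F.
     \<not> (\<exists>T\<in>semigroups_frob F. \<exists>U\<in>semigroups_frob F. S \<subset> T \<and> S \<subset> U \<and> S = T \<inter> U)}"

definition special_gaps :: "nat set \<Rightarrow> nat set" where
  "special_gaps S = {x. x \<notin> S \<and> 2 * x \<in> S \<and> (\<forall>s\<in>S - {0}. x + s \<in> S)}"

text \<open>A vector \<open>(x\<^sub>1, \<dots>, x\<^sub>n)\<close> in \<open>\<nat>\<^sup>n\<close> is a list of length \<open>n\<close>. List indices start at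
  \<open>0\<close>, so the coordinate \<open>x\<^sub>i\<close> of \<open>x\<close> is \<open>x ! (i - 1)\<close>.\<close>

definition kunz :: "nat \<Rightarrow> nat set \<Rightarrow> nat list" where
  "kunz F S = map (\<lambda>i. if i \<in> S then 0 else 1) [1..<Suc F]"

definition vec_join :: "nat list \<Rightarrow> nat list \<Rightarrow> nat list" where
  "vec_join a b = map2 max a b"

definition vec_le :: "nat list \<Rightarrow> nat list \<Rightarrow> bool" where
  "vec_le a b \<longleftrightarrow> list_all2 (\<le>) a b"

definition minimals :: "nat list set \<Rightarrow> nat list set" where
  "minimals X = {x \<in> X. \<forall>y\<in>X. vec_le y x \<longrightarrow> y = x}"

text \<open>Both subtractions below are exact: the first conjuncts give \<open>l < F < 2 * l\<close>.\<close>

definition setL :: "nat \<Rightarrow> nat set" where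
  "setL F = {l. real F / 2 < real l \<and> l < F \<and> ((F - l) dvd F \<or> \<not> (2 * l - F) dvd F)}"

definition setA :: "nat \<Rightarrow> nat \<Rightarrow> nat list set" where
  "setA F l = {x @ replicate (F - l) 0 | x. x \<in> kunz l ` irreducibles_frob l}"

definition setB0 :: "nat \<Rightarrow> nat \<Rightarrow> nat list set" where
  "setB0 F l = {x \<in> kunz F ` irreducibles_frob F. x ! (l - 1) = 0}"

definition setB1 :: "nat \<Rightarrow> nat \<Rightarrow> nat list set" where
  "setB1 F l = {x \<in> kunz F ` irreducibles_frob F. x ! (l - 1) = 1}"

definition setC :: "nat \<Rightarrow> nat \<Rightarrow> nat list set" where
  "setC F l = minimals {vec_join a b | a b. a \<in> setA F l \<and> b \<in> setB0 F l}"

definition setN :: "nat \<Rightarrow> nat \<Rightarrow> nat set set" where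
  "setN F l = {S \<in> semigroups_frob F.
     kunz F S \<in> {c \<in> setC F l. \<forall>b\<in>setB1 F l. vec_join b c \<noteq> c}}"

end

theory Submission
  imports Defs
begin

text \<open>
  Write \<open>E(S)\<close> for the set of special gaps of \<open>S\<close>. Everything rests on the correspondence between
  special gaps and oversemigroups: a gap \<open>x\<close> is special iff \<open>S \<union> {x}\<close> is again a semigroup
  (\<open>numerical_semigroup_insert\<close> is the direction needed), and if \<open>S \<subset> T\<close> then \<open>max (T - S)\<close> is a
  special gap of \<open>S\<close> (\<open>special_gap_in_oversemigroup\<close>). It follows that \<open>S\<close> is irreducible with
  Frobenius number \<open>F\<close> iff \<open>E(S) = {F}\<close> (\<open>irreducibles_frob_iff\<close>), that \<open>S\<close> is atomic iff it is
  irreducible or \<open>E(S) = {l, F}\<close> with \<open>l < F\<close> (\<open>atomics_frob_iff\<close>), and that a semigroup which is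
  maximal among those avoiding a set \<open>G\<close> has all its special gaps in \<open>G\<close>
  (\<open>maximal_avoiding_semigroup\<close>).

  Joins of Kunz vectors are intersections, and smaller vectors are larger semigroups. Hence
  \<open>\<N>(F, l)\<close> consists of the maximal sets of the form \<open>T \<inter> U\<close> with \<open>T \<in> \<I>(l)\<close>, \<open>U \<in> \<I>(F)\<close>,
  \<open>l \<in> U\<close>, that are contained in no \<open>V \<in> \<I>(F)\<close> with \<open>l \<notin> V\<close> (\<open>setN_iff\<close>). If \<open>E(S) = {l, F}\<close>,
  every proper oversemigroup contains \<open>l\<close> or \<open>F\<close>; so extending \<open>S \<union> {l+1, \<dots>}\<close> maximally without
  \<open>l\<close> and \<open>S \<union> {l}\<close> maximally without \<open>F\<close> gives \<open>T\<close> and \<open>U\<close> with \<open>S = T \<inter> U\<close>, and both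
  maximality conditions hold. Conversely, a member of \<open>\<N>(F, l)\<close> extends to a semigroup
  \<open>S'\<close> maximal avoiding \<open>{l, F}\<close>; then \<open>E(S') = {F}\<close> is excluded by the condition on \<open>V\<close>, so
  \<open>E(S') = {l, F}\<close>, and \<open>S'\<close> is itself such an intersection, whence \<open>S = S'\<close> by maximality.

  It remains to see that \<open>E(S) = {l, F}\<close> with \<open>l < F\<close> forces \<open>l \<in> L(F)\<close>
  (\<open>second_special_gap_in_setL\<close>). This uses that a gap \<open>x\<close> with \<open>2x + S \<subseteq> S\<close> can be written as a
  special gap minus an element of \<open>S\<close> (\<open>special_gap_above\<close>), applied to \<open>F - l\<close> and \<open>2 (F - l)\<close>.
\<close>

section \<open>Numerical semigroups with a given Frobenius number\<close>

lemma numerical_semigroupD: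
  assumes "numerical_semigroup S"
  shows "0 \<in> S" "\<And>x y. x \<in> S \<Longrightarrow> y \<in> S \<Longrightarrow> x + y \<in> S" "finite (UNIV - S)"
  using assms by (auto simp: numerical_semigroup_def)

lemma frobenius_eqI:
  assumes "m \<notin> S" "\<And>x. x > m \<Longrightarrow> x \<in> S"
  shows "frobenius S = int m"
  unfolding frobenius_def
proof (rule Greatest_equality)
  show "int m \<notin> int ` S" using assms(1) by auto
next
  fix z assume z: "z \<notin> int ` S"
  show "z \<le> int m"
  proof (rule ccontr)
    assume "\<not> z \<le> int m"
    then have "nat z \<in> S" "z = int (nat z)" using assms(2) by auto
    then show False using z by (metis imageI)
  qed
qed

lemma exists_largest_gap:
  assumes "numerical_semigroup S" "S \<noteq> UNIV"
  obtains m where "m \<notin> S" "\<And>x. x > m \<Longrightarrow> x \<in> S"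
proof
  have fin: "finite (UNIV - S)" using assms(1) by (rule numerical_semigroupD)
  have ne: "UNIV - S \<noteq> {}" using assms(2) by auto
  show "Max (UNIV - S) \<notin> S" using Max_in[OF fin ne] by auto
  show "x \<in> S" if "x > Max (UNIV - S)" for x
    using that Max_ge[OF fin, of x] by auto
qed

lemma semigroups_frob_iff:
  "S \<in> semigroups_frob F \<longleftrightarrow> numerical_semigroup S \<and> F \<notin> S \<and> (\<forall>x>F. x \<in> S)"
proof
  assume S: "S \<in> semigroups_frob F"
  then have ns: "numerical_semigroup S" and fr: "frobenius S = int F"
    by (auto simp: semigroups_frob_def)
  have "S \<noteq> UNIV"
  proof
    assume [simp]: "S = UNIV"
    have "frobenius S = -1"
      unfolding frobenius_def
    proof (rule Greatest_equality)
      show "z \<le> -1" if "z \<notin> int ` S" for z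
        using that zero_le_imp_eq_int[of z] by (cases "0 \<le> z") auto
    qed auto
    then show False using fr by simp
  qed
  then obtain m where m: "m \<notin> S" "\<And>x. x > m \<Longrightarrow> x \<in> S"
    using exists_largest_gap ns by blast
  then have "m = F" using frobenius_eqI[of m S] fr by simp
  then show "numerical_semigroup S \<and> F \<notin> S \<and> (\<forall>x>F. x \<in> S)" using ns m by auto
next
  assume "numerical_semigroup S \<and> F \<notin> S \<and> (\<forall>x>F. x \<in> S)"
  then show "S \<in> semigroups_frob F"
    using frobenius_eqI[of F S] by (auto simp: semigroups_frob_def)
qed

lemma numerical_semigroup_Int:
  assumes "numerical_semigroup S" "numerical_semigroup T"
  shows "numerical_semigroup (S \<inter> T)"
  using assms by (auto simp: numerical_semigroup_def Diff_Int)

lemma numerical_semigroup_Un_greaterThan: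
  assumes "numerical_semigroup S"
  shows "numerical_semigroup (S \<union> {l<..})"
proof -
  have "finite (UNIV - (S \<union> {l<..}))"
    by (rule finite_subset[OF _ numerical_semigroupD(3)[OF assms]]) auto
  then show ?thesis using assms by (auto simp: numerical_semigroup_def)
qed

section \<open>Special gaps and oversemigroups\<close>

lemma numerical_semigroup_insert:
  assumes "numerical_semigroup S" "x \<in> special_gaps S"
  shows "numerical_semigroup (insert x S)"
proof -
  have sp: "x + x \<in> S" "\<And>s. s \<in> S \<Longrightarrow> x + s \<in> insert x S"
    using assms(2) by (auto simp: special_gaps_def mult_2)
  have "finite (UNIV - insert x S)"
    by (rule finite_subset[OF _ numerical_semigroupD(3)[OF assms(1)]]) auto
  moreover have "a + b \<in> insert x S" if "a \<in> insert x S" "b \<in> insert x S" for a b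
    using that sp numerical_semigroupD(2)[OF assms(1), of a b]
    by (metis add.commute insert_iff)
  ultimately show ?thesis
    using numerical_semigroupD(1)[OF assms(1)] by (auto simp: numerical_semigroup_def)
qed

lemma special_gap_in_oversemigroup:
  assumes S: "numerical_semigroup S" and T: "numerical_semigroup T" and "S \<subset> T"
  obtains x where "x \<in> special_gaps S" "x \<in> T"
proof
  let ?x = "Max (T - S)"
  have fin: "finite (T - S)"
    by (rule finite_subset[OF _ numerical_semigroupD(3)[OF S]]) auto
  have "T - S \<noteq> {}" using assms(3) by auto
  then have x: "?x \<in> T" "?x \<notin> S" using Max_in[OF fin] by auto
  have big: "y \<in> S" if "y \<in> T" "y > ?x" for y
    using that Max_ge[OF fin, of y] by auto
  have "?x > 0" using x(2) numerical_semigroupD(1)[OF S] by (metis gr0I)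
  then have "2 * ?x \<in> S"
    using big[of "2 * ?x"] numerical_semigroupD(2)[OF T x(1) x(1)] by (simp add: mult_2)
  moreover have "?x + s \<in> S" if "s \<in> S - {0}" for s
    using that big[of "?x + s"] numerical_semigroupD(2)[OF T x(1), of s] assms(3) by auto
  ultimately show "?x \<in> special_gaps S" using x(2) by (auto simp: special_gaps_def)
  show "?x \<in> T" by (rule x(1))
qed

lemma maximal_avoiding_semigroup:
  assumes S: "numerical_semigroup S" and "S \<inter> G = {}"
  obtains S' where "numerical_semigroup S'" "S \<subseteq> S'" "S' \<inter> G = {}" "special_gaps S' \<subseteq> G"
proof -
  define X where "X = {T. numerical_semigroup T \<and> S \<subseteq> T \<and> T \<inter> G = {}}"
  \<comment> \<open>An oversemigroup is determined by the finite set of gaps of \<open>S\<close> that it contains.\<close>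
  have "X \<subseteq> (\<lambda>Y. S \<union> Y) ` Pow (UNIV - S)"
  proof
    fix T assume "T \<in> X"
    then have "T = S \<union> (T - S)" "T - S \<in> Pow (UNIV - S)" by (auto simp: X_def)
    then show "T \<in> (\<lambda>Y. S \<union> Y) ` Pow (UNIV - S)" by (rule image_eqI)
  qed
  then have "finite X"
    using numerical_semigroupD(3)[OF S] by (meson finite_Pow_iff finite_imageI finite_subset)
  moreover have "S \<in> X" using assms by (auto simp: X_def)
  ultimately obtain S' where S': "S' \<in> X" "\<And>T. T \<in> X \<Longrightarrow> S' \<subseteq> T \<Longrightarrow> S' = T"
    using finite_has_maximal2[of X S] by metis
  have "special_gaps S' \<subseteq> G"
  proof
    fix x assume x: "x \<in> special_gaps S'"
    then have "numerical_semigroup (insert x S')" "x \<notin> S'"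
      using S'(1) numerical_semigroup_insert by (auto simp: X_def special_gaps_def)
    then show "x \<in> G"
      using S'(1) S'(2)[of "insert x S'"] by (auto simp: X_def)
  qed
  then show ?thesis using that S'(1) by (auto simp: X_def)
qed

lemma frobenius_special_gap:
  assumes "S \<in> semigroups_frob F"
  shows "F \<in> special_gaps S"
proof -
  have S: "0 \<in> S" "F \<notin> S" "\<And>x. x > F \<Longrightarrow> x \<in> S"
    using assms by (auto simp: semigroups_frob_iff numerical_semigroup_def)
  then have "F > 0" by (metis gr0I)
  then show ?thesis using S by (auto simp: special_gaps_def)
qed

lemma semigroups_frob_Max_special_gap:
  assumes "numerical_semigroup S" "special_gaps S = {l, F}" "l \<le> F"
  shows "S \<in> semigroups_frob F"
proof -
  have F: "F \<notin> S" using assms(2) by (auto simp: special_gaps_def)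
  then obtain m where m: "m \<notin> S" "\<And>x. x > m \<Longrightarrow> x \<in> S"
    using exists_largest_gap[OF assms(1)] by auto
  then have "S \<in> semigroups_frob m" using assms(1) by (simp add: semigroups_frob_iff)
  then have "m \<in> {l, F}" using frobenius_special_gap assms(2) by blast
  then have "m = F" using m(2)[of F] F assms(3) by (cases "l = F") auto
  with \<open>S \<in> semigroups_frob m\<close> show ?thesis by simp
qed

text \<open>Among the gaps \<open>x + s\<close> with \<open>s \<in> S\<close>, the largest one is special as soon as its double is
  in \<open>S\<close>.\<close>

lemma special_gap_above:
  assumes S: "numerical_semigroup S" and "x \<notin> S" and dbl: "\<And>s. s \<in> S \<Longrightarrow> 2 * x + s \<in> S"
  obtains s where "s \<in> S" "x + s \<in> special_gaps S"
proof -
  let ?M = "{y. y \<notin> S \<and> (\<exists>s\<in>S. y = x + s)}"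
  have fin: "finite ?M"
    by (rule finite_subset[OF _ numerical_semigroupD(3)[OF S]]) auto
  have "x \<in> ?M" using assms(2) numerical_semigroupD(1)[OF S] by force
  then have "Max ?M \<in> ?M" using Max_in[OF fin] by blast
  then obtain s where s: "s \<in> S" "Max ?M = x + s" "x + s \<notin> S" by auto
  have "x + s + t \<in> S" if "t \<in> S - {0}" for t
  proof (rule ccontr)
    assume "x + s + t \<notin> S"
    moreover have "s + t \<in> S" using that s(1) numerical_semigroupD(2)[OF S] by auto
    ultimately have "x + s + t \<in> ?M" by (auto simp: add.assoc)
    then have "x + s + t \<le> Max ?M" by (rule Max_ge[OF fin])
    then show False using that unfolding s(2) by auto
  qed
  moreover have "2 * (x + s) \<in> S"
    using dbl[of "s + s"] numerical_semigroupD(2)[OF S s(1) s(1)] by (simp add: algebra_simps)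
  ultimately have "x + s \<in> special_gaps S" using s(3) by (auto simp: special_gaps_def)
  then show ?thesis using that s(1) by blast
qed

section \<open>Irreducible and atomic semigroups\<close>

lemma irreducibles_frob_iff:
  "S \<in> irreducibles_frob F \<longleftrightarrow> numerical_semigroup S \<and> special_gaps S = {F}"
proof
  assume "S \<in> irreducibles_frob F"
  then have sF: "S \<in> semigroups_frob F" and irr: "irreducible_semigroup S"
    by (auto simp: irreducibles_frob_def)
  have S: "numerical_semigroup S" using sF by (simp add: semigroups_frob_iff)
  have F: "F \<in> special_gaps S" using sF by (rule frobenius_special_gap)
  have "x = F" if x: "x \<in> special_gaps S" for x
  proof (rule ccontr)
    assume "x \<noteq> F"
    then have "S = insert x S \<inter> insert F S" by auto
    moreover have "S \<subset> insert x S" "S \<subset> insert F S" using x F by (auto simp: special_gaps_def)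
    ultimately show False
      using irr numerical_semigroup_insert[OF S x] numerical_semigroup_insert[OF S F]
      unfolding irreducible_semigroup_def by blast
  qed
  then show "numerical_semigroup S \<and> special_gaps S = {F}" using S F by blast
next
  assume a: "numerical_semigroup S \<and> special_gaps S = {F}"
  have "S \<in> semigroups_frob F"
    by (rule semigroups_frob_Max_special_gap[of S F F]) (use a in auto)
  moreover have "F \<notin> S" using a by (auto simp: special_gaps_def)
  moreover have "F \<in> T" if "numerical_semigroup T" "S \<subset> T" for T
    using that a by (metis special_gap_in_oversemigroup singletonD)
  ultimately show "S \<in> irreducibles_frob F"
    using a unfolding irreducibles_frob_def irreducible_semigroup_def by blast
qed

lemma irreducibles_frob_subset: "irreducibles_frob F \<subseteq> semigroups_frob F"
  by (auto simp: irreducibles_frob_def)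

lemma atomics_frob_iff:
  "S \<in> atomics_frob F \<longleftrightarrow>
     S \<in> irreducibles_frob F \<or> (\<exists>l<F. numerical_semigroup S \<and> special_gaps S = {l, F})"
proof
  assume "S \<in> atomics_frob F"
  then have sF: "S \<in> semigroups_frob F"
    and at: "\<And>T U. T \<in> semigroups_frob F \<Longrightarrow> U \<in> semigroups_frob F \<Longrightarrow>
               S \<subset> T \<Longrightarrow> S \<subset> U \<Longrightarrow> S \<noteq> T \<inter> U"
    by (auto simp: atomics_frob_def)
  have S: "numerical_semigroup S" using sF by (simp add: semigroups_frob_iff)
  have F: "F \<in> special_gaps S" using sF by (rule frobenius_special_gap)
  have ins: "insert x S \<in> semigroups_frob F" "S \<subset> insert x S"
    if "x \<in> special_gaps S" "x \<noteq> F" for x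
    using that sF numerical_semigroup_insert[OF S that(1)]
    by (auto simp: semigroups_frob_iff special_gaps_def)
  have uniq: "x = y" if "x \<in> special_gaps S" "x \<noteq> F" "y \<in> special_gaps S" "y \<noteq> F" for x y
  proof (rule ccontr)
    assume "x \<noteq> y"
    then have "S = insert x S \<inter> insert y S" by auto
    then show False using at ins[OF that(1,2)] ins[OF that(3,4)] by blast
  qed
  show "S \<in> irreducibles_frob F \<or> (\<exists>l<F. numerical_semigroup S \<and> special_gaps S = {l, F})"
  proof (cases "special_gaps S = {F}")
    case True
    then show ?thesis using S by (simp add: irreducibles_frob_iff)
  next
    case False
    then obtain l where l: "l \<in> special_gaps S" "l \<noteq> F" using F by blast
    then have "special_gaps S = {l, F}" using F uniq by blast
    moreover have "l < F"
    proof (rule ccontr)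
      assume "\<not> l < F"
      then have "l \<in> S" using l(2) sF by (simp add: semigroups_frob_iff)
      then show False using l(1) by (simp add: special_gaps_def)
    qed
    ultimately show ?thesis using S by blast
  qed
next
  assume "S \<in> irreducibles_frob F \<or> (\<exists>l<F. numerical_semigroup S \<and> special_gaps S = {l, F})"
  then obtain l where l: "l \<le> F" "numerical_semigroup S" "special_gaps S = {l, F}"
    by (metis irreducibles_frob_iff insert_absorb2 order.refl less_imp_le)
  have sF: "S \<in> semigroups_frob F"
    using l by (intro semigroups_frob_Max_special_gap)
  have "l \<notin> S" using l(3) by (auto simp: special_gaps_def)
  moreover have "l \<in> T" if "T \<in> semigroups_frob F" "S \<subset> T" for T
    using special_gap_in_oversemigroup[of S T] that l(2,3) by (auto simp: semigroups_frob_iff)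
  ultimately show "S \<in> atomics_frob F"
    using sF unfolding atomics_frob_def by blast
qed

section \<open>The position of the second special gap\<close>

lemma second_special_gap_in_setL:
  assumes S: "numerical_semigroup S" and E: "special_gaps S = {l, F}" and "l < F"
  shows "l \<in> setL F"
proof -
  have sF: "S \<in> semigroups_frob F"
    using assms by (intro semigroups_frob_Max_special_gap) auto
  have F: "F \<notin> S" "\<And>x. x > F \<Longrightarrow> x \<in> S" using sF by (auto simp: semigroups_frob_iff)
  have "l \<in> special_gaps S" using E by simp
  then have l: "l \<notin> S" "2 * l \<in> S" "\<And>s. s \<in> S \<Longrightarrow> s \<noteq> 0 \<Longrightarrow> l + s \<in> S"
    by (auto simp: special_gaps_def)
  define k where "k = F - l"
  have k: "k > 0" "F = l + k" using \<open>l < F\<close> by (auto simp: k_def)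
  have kS: "k \<notin> S" using l(3)[of k] k F(1) by auto
  \<comment> \<open>The double of a gap above \<open>F / 2\<close> exceeds \<open>F\<close>, so such a gap is \<open>l - s\<close> or \<open>F - s\<close>
    for some \<open>s \<in> S\<close>.\<close>
  have big: "(\<exists>s\<in>S. x + s = F) \<or> (\<exists>s\<in>S. x + s = l)" if "x \<notin> S" "F < 2 * x" for x
    by (rule special_gap_above[OF S that(1)]) (use that F(2) E in auto)
  have half: "F < 2 * l"
  proof (rule ccontr)
    assume "\<not> F < 2 * l"
    moreover have "F \<noteq> 2 * l" using l(2) F(1) by metis
    ultimately have "l < k" using k(2) by linarith
    then show False using big[of k] kS l(1) k by auto
  qed
  have "k dvd F \<or> \<not> (2 * l - F) dvd F"
  proof (rule disjCI)
    assume "\<not> \<not> (2 * l - F) dvd F"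
    define d where "d = 2 * l - F"
    have dF: "d dvd F" using \<open>\<not> \<not> (2 * l - F) dvd F\<close> by (simp add: d_def)
    have d: "d > 0" "l = k + d" "F = 2 * k + d" using half k by (auto simp: d_def)
    have mult: "j * x \<in> S" if "x \<in> S" for j x
      using that numerical_semigroupD(1,2)[OF S] by (induction j) auto
    have dS: "d \<notin> S" using dF F(1) mult by (metis dvdE mult.commute)
    have k2: "2 * k \<notin> S"
    proof
      assume "2 * k \<in> S"
      then obtain s where "s \<in> S" "k + s \<in> special_gaps S"
        using special_gap_above[OF S kS] numerical_semigroupD(2)[OF S] by blast
      then have "k + s = l \<or> k + s = F" using E by auto
      then have "s = d \<or> s = l" using k d by linarith
      then show False using \<open>s \<in> S\<close> l(1) dS by auto
    qed
    \<comment> \<open>Now \<open>d\<close> divides \<open>2k = F - d\<close>, and the bound \<open>k \<le> d\<close> leaves only the quotients \<open>1\<close> and \<open>2\<close>.\<close>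
    have "k \<le> d"
    proof (cases "F < 2 * (2 * k)")
      case True
      then obtain s where "s \<in> S" "2 * k + s = F \<or> 2 * k + s = l" using big[OF k2] by blast
      then have "s = d \<or> k + s = d" using d by linarith
      then show ?thesis using \<open>s \<in> S\<close> dS by auto
    next
      case False
      then show ?thesis using d by auto
    qed
    have "d dvd 2 * k" using dF d(3) by (simp add: dvd_add_left_iff)
    then obtain q where q: "2 * k = d * q" by blast
    have "q \<le> 2"
    proof (rule ccontr)
      assume "\<not> q \<le> 2"
      then have "d * 3 \<le> d * q" by simp
      then show False using q \<open>k \<le> d\<close> d(1) by linarith
    qed
    then have "q = 1 \<or> q = 2" using q k(1) by (cases q rule: nat.exhaust) (auto simp: le_Suc_eq)
    then have "F = k * 4 \<or> F = k * 3" using q d(3) by auto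
    then show "k dvd F" by auto
  qed
  then show ?thesis using half \<open>l < F\<close> by (auto simp: setL_def k_def)
qed

section \<open>Kunz coordinates\<close>

lemma length_kunz [simp]: "length (kunz F S) = F"
  by (simp add: kunz_def)

lemma nth_kunz [simp]: "i < F \<Longrightarrow> kunz F S ! i = (if Suc i \<in> S then 0 else 1)"
  unfolding kunz_def by (subst nth_map) (auto simp del: upt_Suc)

lemma semigroups_frob_subset_iff:
  assumes "S \<in> semigroups_frob F" "T \<in> semigroups_frob F"
  shows "S \<subseteq> T \<longleftrightarrow> (\<forall>i<F. Suc i \<in> S \<longrightarrow> Suc i \<in> T)"
proof
  assume R: "\<forall>i<F. Suc i \<in> S \<longrightarrow> Suc i \<in> T"
  show "S \<subseteq> T"
  proof
    fix x assume "x \<in> S"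
    show "x \<in> T"
    proof (cases "x = 0 \<or> x > F")
      case True
      then show ?thesis using assms(2) by (auto simp: semigroups_frob_iff numerical_semigroup_def)
    next
      case False
      then obtain i where "x = Suc i" "i < F" by (cases x) auto
      then show ?thesis using R \<open>x \<in> S\<close> by auto
    qed
  qed
qed auto

lemma vec_le_kunz_iff:
  assumes "S \<in> semigroups_frob F" "T \<in> semigroups_frob F"
  shows "vec_le (kunz F S) (kunz F T) \<longleftrightarrow> T \<subseteq> S"
  unfolding semigroups_frob_subset_iff[OF assms(2,1)]
  by (auto simp: vec_le_def list_all2_conv_all_nth)

lemma kunz_eq_iff:
  assumes "S \<in> semigroups_frob F" "T \<in> semigroups_frob F"
  shows "kunz F S = kunz F T \<longleftrightarrow> S = T"
proof
  assume "kunz F S = kunz F T"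
  then have "vec_le (kunz F S) (kunz F T)" "vec_le (kunz F T) (kunz F S)"
    by (auto simp: vec_le_def list_all2_conv_all_nth)
  then show "S = T" using vec_le_kunz_iff assms by blast
qed simp

lemma vec_join_kunz: "vec_join (kunz F S) (kunz F T) = kunz F (S \<inter> T)"
  by (rule nth_equalityI) (auto simp: vec_join_def)

text \<open>Padding with zeros is harmless because \<open>T\<close> contains every integer above \<open>l\<close>.\<close>

lemma kunz_append_zeros:
  assumes "T \<in> semigroups_frob l" "l < F"
  shows "kunz l T @ replicate (F - l) 0 = kunz F T"
  by (rule nth_equalityI) (use assms in \<open>auto simp: nth_append semigroups_frob_iff\<close>)

section \<open>The sets \<open>\<N>(F, l)\<close>\<close>

text \<open>The semigroups \<open>T \<inter> U\<close> whose Kunz vectors are the joins \<open>a \<or> b\<close> with \<open>a \<in> A\<close> and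
  \<open>b \<in> B\<^sub>0\<close>.\<close>

definition irreducible_meets :: "nat \<Rightarrow> nat \<Rightarrow> nat set set" where
  "irreducible_meets F l =
     {T \<inter> U | T U. T \<in> irreducibles_frob l \<and> U \<in> irreducibles_frob F \<and> l \<in> U}"

lemma irreducible_meets_frob:
  assumes "l < F"
  shows "irreducible_meets F l \<subseteq> semigroups_frob F"
proof
  fix S assume "S \<in> irreducible_meets F l"
  then obtain T U where "S = T \<inter> U" "T \<in> semigroups_frob l" "U \<in> semigroups_frob F"
    using irreducibles_frob_subset by (auto simp: irreducible_meets_def)
  then show "S \<in> semigroups_frob F"
    using assms by (auto simp: semigroups_frob_iff numerical_semigroup_Int)
qed

lemma setA_eq:
  assumes "l < F"
  shows "setA F l = kunz F ` irreducibles_frob l"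
proof -
  have "setA F l = (\<lambda>T. kunz l T @ replicate (F - l) 0) ` irreducibles_frob l"
    by (auto simp: setA_def)
  also have "\<dots> = kunz F ` irreducibles_frob l"
    using kunz_append_zeros[OF _ assms] irreducibles_frob_subset by (intro image_cong) auto
  finally show ?thesis .
qed

lemma setB0_eq:
  assumes "0 < l" "l < F"
  shows "setB0 F l = kunz F ` {U \<in> irreducibles_frob F. l \<in> U}"
  using assms by (auto simp: setB0_def split: if_splits)

lemma setB1_eq:
  assumes "0 < l" "l < F"
  shows "setB1 F l = kunz F ` {V \<in> irreducibles_frob F. l \<notin> V}"
  using assms by (auto simp: setB1_def split: if_splits)

lemma setC_eq:
  assumes "0 < l" "l < F"
  shows "setC F l = minimals (kunz F ` irreducible_meets F l)"
proof -
  have "{vec_join a b | a b. a \<in> kunz F ` X \<and> b \<in> kunz F ` Y} =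
      kunz F ` {T \<inter> U | T U. T \<in> X \<and> U \<in> Y}" for X Y
  proof -
    have "{vec_join a b | a b. a \<in> kunz F ` X \<and> b \<in> kunz F ` Y} =
        {vec_join (kunz F T) (kunz F U) | T U. T \<in> X \<and> U \<in> Y}"
      by blast
    then show ?thesis unfolding vec_join_kunz by blast
  qed
  then show ?thesis
    by (simp add: setC_def setA_eq[OF assms(2)] setB0_eq[OF assms] irreducible_meets_def)
qed

lemma setN_iff:
  assumes "0 < l" "l < F"
  shows "S \<in> setN F l \<longleftrightarrow>
    S \<in> irreducible_meets F l \<and>
    (\<forall>S'\<in>irreducible_meets F l. S \<subseteq> S' \<longrightarrow> S' = S) \<and>
    (\<forall>V\<in>irreducibles_frob F. l \<notin> V \<longrightarrow> \<not> S \<subseteq> V)"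
proof (cases "S \<in> semigroups_frob F")
  case True
  note P = subsetD[OF irreducible_meets_frob[OF assms(2)]]
  have "kunz F S \<in> kunz F ` irreducible_meets F l \<longleftrightarrow> S \<in> irreducible_meets F l"
    using kunz_eq_iff[OF True P] by auto
  then have C: "kunz F S \<in> setC F l \<longleftrightarrow> S \<in> irreducible_meets F l \<and>
      (\<forall>S'\<in>irreducible_meets F l. S \<subseteq> S' \<longrightarrow> S' = S)"
    using vec_le_kunz_iff[OF P True] kunz_eq_iff[OF P True]
    by (auto simp: setC_eq[OF assms] minimals_def)
  have "vec_join (kunz F V) (kunz F S) = kunz F S \<longleftrightarrow> S \<subseteq> V" if "V \<in> irreducibles_frob F" for V
  proof -
    have "V \<in> semigroups_frob F" using that irreducibles_frob_subset by auto
    then have "V \<inter> S \<in> semigroups_frob F"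
      using True by (auto simp: semigroups_frob_iff numerical_semigroup_Int)
    then show ?thesis using True by (auto simp: vec_join_kunz kunz_eq_iff)
  qed
  then have "(\<forall>b\<in>setB1 F l. vec_join b (kunz F S) \<noteq> kunz F S) \<longleftrightarrow>
      (\<forall>V\<in>irreducibles_frob F. l \<notin> V \<longrightarrow> \<not> S \<subseteq> V)"
    by (auto simp: setB1_eq[OF assms])
  with C True show ?thesis by (auto simp: setN_def)
next
  case False
  then show ?thesis using irreducible_meets_frob[OF assms(2)] by (auto simp: setN_def)
qed

lemma oversemigroup_eq_if_avoids_special_gaps:
  assumes "numerical_semigroup S" "numerical_semigroup T" "S \<subseteq> T" "special_gaps S \<inter> T = {}"
  shows "T = S"
  using assms by (metis special_gap_in_oversemigroup disjoint_iff psubsetI)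

lemma irreducible_frob_extension:
  assumes "S \<in> semigroups_frob F"
  obtains T where "T \<in> irreducibles_frob F" "S \<subseteq> T"
proof -
  have "numerical_semigroup S" "S \<inter> {F} = {}" using assms by (auto simp: semigroups_frob_iff)
  then obtain T where T: "numerical_semigroup T" "S \<subseteq> T" "T \<inter> {F} = {}" "special_gaps T \<subseteq> {F}"
    using maximal_avoiding_semigroup by metis
  then have "T \<in> semigroups_frob F" using assms by (auto simp: semigroups_frob_iff)
  then have "special_gaps T = {F}" using T(4) frobenius_special_gap by blast
  then show ?thesis using that T by (auto simp: irreducibles_frob_iff)
qed

lemma two_special_gaps_in_irreducible_meets:
  assumes S: "numerical_semigroup S" and E: "special_gaps S = {l, F}" and "l < F"
  shows "S \<in> irreducible_meets F l"
proof -
  have sF: "S \<in> semigroups_frob F"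
    using assms by (intro semigroups_frob_Max_special_gap) auto
  have lS: "l \<notin> S" using E by (auto simp: special_gaps_def)
  have "S \<union> {l<..} \<in> semigroups_frob l"
    using numerical_semigroup_Un_greaterThan[OF S] lS by (auto simp: semigroups_frob_iff)
  then obtain T where T: "T \<in> irreducibles_frob l" "S \<union> {l<..} \<subseteq> T"
    using irreducible_frob_extension by metis
  have "numerical_semigroup (insert l S)"
    using numerical_semigroup_insert[OF S] E by auto
  moreover have "insert l S \<in> semigroups_frob F"
    using calculation sF \<open>l < F\<close> by (auto simp: semigroups_frob_iff)
  ultimately obtain U where U: "U \<in> irreducibles_frob F" "insert l S \<subseteq> U"
    using irreducible_frob_extension by metis
  have "l \<notin> T" "F \<notin> U" "numerical_semigroup (T \<inter> U)"
    using T(1) U(1) irreducibles_frob_subset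
    by (auto simp: irreducibles_frob_def semigroups_frob_iff numerical_semigroup_Int)
  then have "T \<inter> U = S"
    using oversemigroup_eq_if_avoids_special_gaps[of S "T \<inter> U"] S T U E by auto
  then show ?thesis using T U by (auto simp: irreducible_meets_def)
qed

lemma setN_eq:
  assumes "0 < l" "F < 2 * l" "l < F"
  shows "setN F l = {S. numerical_semigroup S \<and> special_gaps S = {l, F}}"
proof (intro equalityI subsetI CollectI)
  fix S assume "S \<in> setN F l"
  then have S: "S \<in> irreducible_meets F l"
    and mx: "\<And>S'. S' \<in> irreducible_meets F l \<Longrightarrow> S \<subseteq> S' \<Longrightarrow> S' = S"
    and V: "\<And>V. V \<in> irreducibles_frob F \<Longrightarrow> l \<notin> V \<Longrightarrow> \<not> S \<subseteq> V"
    using setN_iff[OF assms(1,3)] by auto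
  have sF: "S \<in> semigroups_frob F" using S irreducible_meets_frob[OF assms(3)] by auto
  have "l \<notin> S" using S
    by (auto simp: irreducible_meets_def irreducibles_frob_def semigroups_frob_iff)
  then have "S \<inter> {l, F} = {}" using sF by (auto simp: semigroups_frob_iff)
  then obtain S' where S': "numerical_semigroup S'" "S \<subseteq> S'" "S' \<inter> {l, F} = {}"
      "special_gaps S' \<subseteq> {l, F}"
    using maximal_avoiding_semigroup[of S "{l, F}"] sF by (auto simp: semigroups_frob_iff)
  have "S' \<in> semigroups_frob F" using S' sF by (auto simp: semigroups_frob_iff)
  then have F: "F \<in> special_gaps S'" by (rule frobenius_special_gap)
  have "l \<in> special_gaps S'"
  proof (rule ccontr)
    assume "l \<notin> special_gaps S'"
    then have "special_gaps S' = {F}" using F S'(4) by auto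
    then have "S' \<in> irreducibles_frob F" using S'(1) by (simp add: irreducibles_frob_iff)
    then show False using V[of S'] S'(2,3) by auto
  qed
  then have E: "special_gaps S' = {l, F}" using F S'(4) by auto
  then have "S' = S"
    using mx S'(1,2) two_special_gaps_in_irreducible_meets[OF S'(1) E assms(3)] by blast
  then show "numerical_semigroup S \<and> special_gaps S = {l, F}" using S'(1) E by simp
next
  fix S assume "S \<in> {S. numerical_semigroup S \<and> special_gaps S = {l, F}}"
  then have S: "numerical_semigroup S" and E: "special_gaps S = {l, F}" by auto
  have "S' = S" if "S' \<in> irreducible_meets F l" "S \<subseteq> S'" for S'
  proof (rule oversemigroup_eq_if_avoids_special_gaps[OF S _ that(2)])
    show "numerical_semigroup S'"
      using that(1) irreducible_meets_frob[OF assms(3)] by (auto simp: semigroups_frob_iff)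
    show "special_gaps S \<inter> S' = {}"
      using that(1) E
      by (auto simp: irreducible_meets_def irreducibles_frob_def semigroups_frob_iff)
  qed
  moreover have "\<not> S \<subseteq> V" if "V \<in> irreducibles_frob F" "l \<notin> V" for V
  proof
    assume "S \<subseteq> V"
    have "numerical_semigroup V" "F \<notin> V" "special_gaps V = {F}"
      using that(1) frobenius_special_gap
      by (auto simp: irreducibles_frob_iff special_gaps_def)
    then have "V = S"
      using oversemigroup_eq_if_avoids_special_gaps[OF S _ \<open>S \<subseteq> V\<close>] E that(2) by auto
    then show False using \<open>special_gaps V = {F}\<close> E assms(3) by auto
  qed
  ultimately show "S \<in> setN F l"
    using two_special_gaps_in_irreducible_meets[OF S E assms(3)]
    unfolding setN_iff[OF assms(1,3)] by simp
qed

theorem mainTheorem3: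
  fixes F :: nat
  assumes "F > 0"
  shows "(\<forall>l\<in>setL F. setN F l = {S. numerical_semigroup S \<and> special_gaps S = {l, F}}) \<and>
         atomics_frob F = irreducibles_frob F \<union> (\<Union>l\<in>setL F. setN F l)"
proof
  show N: "\<forall>l\<in>setL F. setN F l = {S. numerical_semigroup S \<and> special_gaps S = {l, F}}"
  proof
    fix l assume "l \<in> setL F"
    then have "F < 2 * l" "l < F" by (auto simp: setL_def)
    then show "setN F l = {S. numerical_semigroup S \<and> special_gaps S = {l, F}}"
      by (intro setN_eq) auto
  qed
  have "l < F" if "l \<in> setL F" for l using that by (simp add: setL_def)
  then have "(\<exists>l<F. numerical_semigroup S \<and> special_gaps S = {l, F}) \<longleftrightarrow>
      (\<exists>l\<in>setL F. S \<in> setN F l)" for S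
    using N second_special_gap_in_setL[of S _ F] by blast
  then show "atomics_frob F = irreducibles_frob F \<union> (\<Union>l\<in>setL F. setN F l)"
    by (auto simp: set_eq_iff atomics_frob_iff)
qed

end
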